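(* If $n$ is odd ($n\ge2$), then the Frobenius-Schur indicator of every irreducible representation of $J_n=\mathbb{C}^{S_{n-1}}\#\mathbb{C}C_n$ is nonnegative.
   Context: Identify $\{1,\dots,n\}$ with $\mathbb{Z}/n\mathbb{Z}$ and $S_n$ with the bijections of $\mathbb{Z}/n\mathbb{Z}$ under composition (right-to-left). $S_{n-1}$ is the subgroup of those $x$ with $x(n)=n$; $a=(1\,2\,\cdots\,n)$; $C_n=\langle a\rangle$. Each product $xa^r$ ($x\in S_{n-1}$) factors uniquely as $xa^r=(x\rhd a^r)(x\lhd a^r)$ with $x\rhd a^r\in C_n$, $x\lhd a^r\in S_{n-1}$; explicitly $x\rhd a^r=a^{x(r)}$ and $x\lhd a^r=a^{-x(r)}xa^r$. $J_n$ is the semisimple Hopf algebra over $\mathbb{C}$ with basis $p_y\#b$ ($y\in S_{n-1}$, $b\in C_n$), product $(p_y\#b)(p_z\#c)=\delta_{z,\,y\lhd b}\,p_y\#bc$, unit $\sum_y p_y\#1$, counit $\varepsilon(p_y\#b)=\delta_{y,1}$, coproduct $\Delta(p_y\#b)=\sum_{z}(p_{yz^{-1}}\#(z\rhd b))\otimes(p_z\#b)$, antipode $S(p_y\#b)=p_{(y\lhd b)^{-1}}\#(y\rhd b)^{-1}$. The Frobenius-Schur indicator of a $J_n$-module with character $\chi$ is $\nu(\chi)=\chi(\sum\Lambda_1\Lambda_2)$, where $\Lambda$ is the two-sided integral of $J_n$ with $\varepsilon(\Lambda)=1$ and $\Delta(\Lambda)=\sum\Lambda_1\otimes\Lambda_2$.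 *)

theory Defs
  imports Complex_Main "HOL-Combinatorics.Permutations"
begin

section \<open>The factorisation of the symmetric group\<close>

text \<open>
  Elements of \<open>S\<^sub>n\<close> are functions on \<^typ>\<open>nat\<close> that permute \<open>{1..n}\<close> and fix everything else;
  the residue class of 0 is represented by \<open>n\<close>.
\<close>

type_synonym perm = "nat \<Rightarrow> nat"

definition cyc :: "nat \<Rightarrow> perm" where
  "cyc n i = (if 1 \<le> i \<and> i < n then i + 1 else if i = n then 1 else i)"

definition C_group :: "nat \<Rightarrow> perm set" where
  "C_group n = {cyc n ^^ r | r. True}"

definition S_group :: "nat \<Rightarrow> perm set" where
  "S_group n = {x. x permutes {1..n} \<and> x n = n}"

text \<open>
  If \<open>b = a\<^sup>r\<close> then \<open>b n\<close> is the representative of \<open>r\<close> in \<open>{1..n}\<close>, so the following two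
  definitions say \<open>x \<rhd> a\<^sup>r = a\<^bsup>x(r)\<^esup>\<close> and \<open>x \<lhd> a\<^sup>r = a\<^bsup>-x(r)\<^esup> x a\<^sup>r\<close>.
  Lemma \<open>factorisation_unique\<close> below confirms that they are the components of the unique
  factorisation of \<open>x a\<^sup>r\<close>.
\<close>

definition lact :: "nat \<Rightarrow> perm \<Rightarrow> perm \<Rightarrow> perm" where
  "lact n x b = cyc n ^^ x (b n)"

definition ract :: "nat \<Rightarrow> perm \<Rightarrow> perm \<Rightarrow> perm" where
  "ract n x b = inv (lact n x b) \<circ> x \<circ> b"


section \<open>The Hopf algebra\<close>

text \<open>
  The index \<open>(y, b)\<close> stands for the basis element \<open>p\<^sub>y # b\<close>.  An element of the algebra is its
  coefficient function, which vanishes outside \<open>J_index n\<close>.  Elements of the tensor square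
  are coefficient functions on pairs of indices.
\<close>

type_synonym jidx = "perm \<times> perm"
type_synonym jelt = "jidx \<Rightarrow> complex"

definition J_index :: "nat \<Rightarrow> jidx set" where
  "J_index n = S_group n \<times> C_group n"

definition J_carrier :: "nat \<Rightarrow> jelt set" where
  "J_carrier n = {f. \<forall>u. u \<notin> J_index n \<longrightarrow> f u = 0}"

definition J_basis :: "jidx \<Rightarrow> jelt" where
  "J_basis u = (\<lambda>v. if v = u then 1 else 0)"

definition J_basis_mult :: "nat \<Rightarrow> jidx \<Rightarrow> jidx \<Rightarrow> jelt" where
  "J_basis_mult n = (\<lambda>(y, b) (z, c).
     if z = ract n y b then J_basis (y, b \<circ> c) else (\<lambda>_. 0))"

text \<open>The multiplication as a linear map on the tensor square, and the product it induces.\<close>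

definition J_mult_tensor :: "nat \<Rightarrow> (jidx \<times> jidx \<Rightarrow> complex) \<Rightarrow> jelt" where
  "J_mult_tensor n t =
     (\<lambda>w. \<Sum>u\<in>J_index n. \<Sum>v\<in>J_index n. t (u, v) * J_basis_mult n u v w)"

definition J_mult :: "nat \<Rightarrow> jelt \<Rightarrow> jelt \<Rightarrow> jelt" where
  "J_mult n f g = J_mult_tensor n (\<lambda>(u, v). f u * g v)"

definition J_unit :: "nat \<Rightarrow> jelt" where
  "J_unit n = (\<lambda>w. \<Sum>y\<in>S_group n. J_basis (y, id) w)"

definition J_counit :: "nat \<Rightarrow> jelt \<Rightarrow> complex" where
  "J_counit n f = (\<Sum>(y, b)\<in>J_index n. f (y, b) * (if y = id then 1 else 0))"

definition J_comult :: "nat \<Rightarrow> jelt \<Rightarrow> (jidx \<times> jidx \<Rightarrow> complex)" where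
  "J_comult n f = (\<lambda>(u, v). \<Sum>(y, b)\<in>J_index n. f (y, b) *
     (\<Sum>z\<in>S_group n. J_basis (y \<circ> inv z, lact n z b) u * J_basis (z, b) v))"

definition J_antipode :: "nat \<Rightarrow> jelt \<Rightarrow> jelt" where
  "J_antipode n f = (\<lambda>w. \<Sum>(y, b)\<in>J_index n.
     f (y, b) * J_basis (inv (ract n y b), inv (lact n y b)) w)"

definition is_normalized_integral :: "nat \<Rightarrow> jelt \<Rightarrow> bool" where
  "is_normalized_integral n L \<longleftrightarrow>
     L \<in> J_carrier n \<and>
     (\<forall>h\<in>J_carrier n. J_mult n h L = (\<lambda>w. J_counit n h * L w)) \<and>
     (\<forall>h\<in>J_carrier n. J_mult n L h = (\<lambda>w. J_counit n h * L w)) \<and>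
     J_counit n L = 1"

text \<open>Existence and uniqueness are shown in \<open>normalized_integral_ex1\<close> below.\<close>

definition J_integral :: "nat \<Rightarrow> jelt" where
  "J_integral n = (THE L. is_normalized_integral n L)"


section \<open>Representations and indicators\<close>

definition J_module ::
  "nat \<Rightarrow> (complex \<Rightarrow> 'v \<Rightarrow> 'v) \<Rightarrow> (jelt \<Rightarrow> 'v \<Rightarrow> 'v::ab_group_add) \<Rightarrow> bool" where
  "J_module n scale act \<longleftrightarrow>
     vector_space scale \<and>
     (\<forall>h\<in>J_carrier n. Vector_Spaces.linear scale scale (act h)) \<and>
     (\<forall>h\<in>J_carrier n. \<forall>k\<in>J_carrier n. \<forall>v. act (\<lambda>w. h w + k w) v = act h v + act k v) \<and>
     (\<forall>c. \<forall>h\<in>J_carrier n. \<forall>v. act (\<lambda>w. c * h w) v = scale c (act h v)) \<and>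
     (\<forall>h\<in>J_carrier n. \<forall>k\<in>J_carrier n. \<forall>v. act (J_mult n h k) v = act h (act k v)) \<and>
     (\<forall>v. act (J_unit n) v = v)"

definition irreducible_J_module ::
  "nat \<Rightarrow> (complex \<Rightarrow> 'v \<Rightarrow> 'v) \<Rightarrow> (jelt \<Rightarrow> 'v \<Rightarrow> 'v::ab_group_add) \<Rightarrow> bool" where
  "irreducible_J_module n scale act \<longleftrightarrow>
     J_module n scale act \<and> (\<exists>v::'v. v \<noteq> 0) \<and>
     (\<forall>W. module.subspace scale W \<and> (\<forall>h\<in>J_carrier n. act h ` W \<subseteq> W) \<longrightarrow> W = {0} \<or> W = UNIV)"

text \<open>
  The trace is meaningful for finite-dimensional spaces only.  No finiteness is imposed on
  irreducible modules, since they are spanned by the finitely many images of any nonzero vector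
  under the basis of the algebra.
\<close>

definition (in vector_space) trace :: "('b \<Rightarrow> 'b) \<Rightarrow> 'a" where
  "trace f = (let B = (SOME B. independent B \<and> span B = UNIV)
              in \<Sum>b\<in>B. representation B (f b) b)"

definition J_character ::
  "(complex \<Rightarrow> 'v \<Rightarrow> 'v) \<Rightarrow> (jelt \<Rightarrow> 'v \<Rightarrow> 'v::ab_group_add) \<Rightarrow> jelt \<Rightarrow> complex" where
  "J_character scale act h = vector_space.trace scale (act h)"

definition FS_indicator :: "nat \<Rightarrow> (jelt \<Rightarrow> complex) \<Rightarrow> complex" where
  "FS_indicator n \<chi> = \<chi> (J_mult_tensor n (J_comult n (J_integral n)))"


section \<open>Well-definedness of the factorisation and of the integral\<close>

lemma cyc_pow:
  assumes "1 \<le> i" "i \<le> n"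
  shows "(cyc n ^^ k) i = (i + k - 1) mod n + 1"
proof (induction k)
  case 0
  then show ?case using assms by simp
next
  case (Suc k)
  define j where "j = (i + k - 1) mod n"
  have "j < n" using assms by (simp add: j_def)
  moreover have "(i + Suc k - 1) mod n = Suc j mod n"
    using assms by (simp add: j_def mod_Suc_eq)
  moreover have "(cyc n ^^ Suc k) i = cyc n (j + 1)"
    using Suc by (simp add: j_def)
  moreover have "cyc n (j + 1) = Suc j mod n + 1"
    using \<open>j < n\<close> by (simp add: cyc_def mod_Suc)
  ultimately show ?case by (simp del: funpow.simps)
qed

lemma cyc_pow_outside:
  assumes "2 \<le> n" "\<not> (1 \<le> i \<and> i \<le> n)"
  shows "(cyc n ^^ k) i = i"
  using assms by (induction k) (auto simp: cyc_def)

lemma cyc_pow_n: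
  assumes "n > 0"
  shows "(cyc n ^^ k) n = (if k mod n = 0 then n else k mod n)"
proof (cases k)
  case (Suc m)
  then have "(cyc n ^^ k) n = m mod n + 1"
    using cyc_pow[of n n k] assms by simp
  then show ?thesis using Suc by (simp add: mod_Suc)
qed simp

lemma cyc_pow_mod:
  assumes "2 \<le> n"
  shows "cyc n ^^ (k mod n) = cyc n ^^ k"
proof
  fix i
  show "(cyc n ^^ (k mod n)) i = (cyc n ^^ k) i"
  proof (cases "1 \<le> i \<and> i \<le> n")
    case True
    then obtain j where "i = Suc j" by (cases i) auto
    then show ?thesis using True by (simp add: cyc_pow mod_add_right_eq)
  next
    case False
    then show ?thesis using cyc_pow_outside[OF assms False] by simp
  qed
qed

lemma cyc_pow_period: "2 \<le> n \<Longrightarrow> cyc n ^^ n = id"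
  using cyc_pow_mod[of n n] by (simp add: id_def)

lemma cyc_permutes:
  assumes "2 \<le> n"
  shows "cyc n permutes {1..n}"
proof -
  obtain m where m: "n = Suc m" using assms by (cases n) auto
  have "cyc n \<circ> cyc n ^^ m = id"
    using cyc_pow_period[OF assms] unfolding m by simp
  moreover have "cyc n ^^ m \<circ> cyc n = id"
    using cyc_pow_period[OF assms] unfolding m by (simp add: funpow_Suc_right del: funpow.simps)
  ultimately have "bij (cyc n)" by (rule o_bij[rotated])
  moreover have "cyc n i = i" if "i \<notin> {1..n}" for i
    using cyc_pow_outside[OF assms, of i 1] that by auto
  ultimately show ?thesis by (simp add: bij_iff permutes_def)
qed

lemma C_group_permutes:
  assumes "2 \<le> n" "b \<in> C_group n"
  shows "b permutes {1..n}"
proof -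
  have "cyc n ^^ r permutes {1..n}" for r
  proof (induction r)
    case (Suc r)
    then show ?case using permutes_compose[OF Suc cyc_permutes[OF assms(1)]] by (simp only: funpow.simps)
  qed (simp add: id_def[symmetric] permutes_id)
  then show ?thesis using assms(2) by (auto simp: C_group_def)
qed

lemma C_group_eq:
  assumes "2 \<le> n" "b \<in> C_group n"
  shows "b = cyc n ^^ b n"
proof -
  obtain r where r: "b = cyc n ^^ r" using assms(2) by (auto simp: C_group_def)
  have "cyc n ^^ b n = cyc n ^^ (r mod n)"
    using assms(1) cyc_pow_period[OF assms(1)] by (simp add: r cyc_pow_n id_def)
  then show ?thesis using cyc_pow_mod[OF assms(1)] r by simp
qed

lemma lact_C_group: "lact n x b \<in> C_group n"
  by (auto simp: lact_def C_group_def)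

lemma ract_S_group:
  assumes "2 \<le> n" "x \<in> S_group n" "b \<in> C_group n"
  shows "ract n x b \<in> S_group n"
proof -
  have l: "lact n x b permutes {1..n}" and b: "b permutes {1..n}"
    using C_group_permutes assms lact_C_group by blast+
  have x: "x permutes {1..n}" "x n = n" using assms by (auto simp: S_group_def)
  have "b n \<in> {1..n}" using assms(1) permutes_in_image[OF b, of n] by simp
  then have "x (b n) \<in> {1..n}" using permutes_in_image[OF x(1)] by blast
  then have "lact n x b n = x (b n)"
    using assms(1) by (cases "x (b n) = n") (auto simp: lact_def cyc_pow_n)
  then have "ract n x b n = n"
    using permutes_inverses(2)[OF l, of n] by (simp add: ract_def)
  moreover have "ract n x b permutes {1..n}"
    unfolding ract_def by (intro permutes_compose permutes_inv l b x(1))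
  ultimately show ?thesis by (simp add: S_group_def)
qed

lemma factorisation:
  assumes "2 \<le> n"
  shows "x \<circ> b = lact n x b \<circ> ract n x b"
  using permutes_inverses(1)[OF C_group_permutes[OF assms lact_C_group]]
  by (simp add: ract_def fun_eq_iff)

lemma factorisation_unique:
  assumes "2 \<le> n" "c \<in> C_group n" "y \<in> S_group n" "x \<circ> b = c \<circ> y"
  shows "c = lact n x b" "y = ract n x b"
proof -
  have "c n = x (b n)"
    using assms(3) fun_cong[OF assms(4), of n] by (simp add: S_group_def)
  then show c: "c = lact n x b"
    using C_group_eq[OF assms(1,2)] by (simp add: lact_def)
  show "y = ract n x b"
    using permutes_inverses(2)[OF C_group_permutes[OF assms(1,2)]] assms(4)
    by (simp add: ract_def fun_eq_iff flip: c)
qed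

lemma id_S_group: "id \<in> S_group n"
  by (simp add: S_group_def permutes_id)

lemma id_C_group: "id \<in> C_group n"
  unfolding C_group_def by (auto intro!: exI[of _ 0])

lemma C_group_comp: "b \<in> C_group n \<Longrightarrow> c \<in> C_group n \<Longrightarrow> b \<circ> c \<in> C_group n"
  unfolding C_group_def by (auto simp flip: funpow_add)

lemma C_group_commute: "b \<in> C_group n \<Longrightarrow> c \<in> C_group n \<Longrightarrow> b \<circ> c = c \<circ> b"
  unfolding C_group_def by (auto simp: add.commute simp flip: funpow_add)

lemma C_group_inv:
  assumes "2 \<le> n" "b \<in> C_group n"
  shows "\<exists>c\<in>C_group n. b \<circ> c = id \<and> c \<circ> b = id"
proof -
  obtain r where r: "b = cyc n ^^ (r mod n)"
    using assms cyc_pow_mod[OF assms(1)] by (force simp: C_group_def)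
  define c where "c = cyc n ^^ (n - r mod n)"
  have "r mod n < n" using assms(1) by simp
  then have "b \<circ> c = id" "c \<circ> b = id"
    using cyc_pow_period[OF assms(1)] by (simp_all add: r c_def flip: funpow_add)
  then show ?thesis by (auto simp: c_def C_group_def)
qed

lemma C_group_image:
  assumes "2 \<le> n"
  shows "C_group n = (\<lambda>r. cyc n ^^ r) ` {..<n}"
  using cyc_pow_mod[OF assms] assms
  by (force simp: C_group_def image_iff intro: bexI[of _ "_ mod n"])

lemma finite_C_group: "2 \<le> n \<Longrightarrow> finite (C_group n)"
  by (simp add: C_group_image)

lemma card_C_group:
  assumes "2 \<le> n"
  shows "card (C_group n) = n"
proof -
  have "inj_on (\<lambda>r. cyc n ^^ r) {..<n}"
  proof (rule inj_onI)
    fix r s assume rs: "r \<in> {..<n}" "s \<in> {..<n}" and eq: "cyc n ^^ r = cyc n ^^ s"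
    have "(cyc n ^^ r) n = (cyc n ^^ s) n" by (simp only: eq)
    with rs assms show "r = s" by (auto simp: cyc_pow_n split: if_splits)
  qed
  then show ?thesis by (simp add: C_group_image[OF assms] card_image)
qed

lemma finite_S_group: "finite (S_group n)"
  by (rule finite_subset[OF _ finite_permutations[of "{1..n}"]]) (auto simp: S_group_def)

lemma ract_id_left: "2 \<le> n \<Longrightarrow> b \<in> C_group n \<Longrightarrow> ract n id b = id"
  using factorisation_unique(2)[of n b id id b] id_S_group by simp

lemma ract_eq_id:
  assumes "2 \<le> n" "y \<in> S_group n" "b \<in> C_group n" "ract n y b = id"
  shows "y = id"
proof -
  have e: "y \<circ> b = lact n y b" using factorisation[OF assms(1), of y b] assms(4) by simp
  obtain c where c: "c \<in> C_group n" "b \<circ> c = id" using C_group_inv[OF assms(1,3)] by blast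
  have "y = lact n y b \<circ> c" using e c(2) by (metis comp_assoc comp_id)
  then have yC: "y \<in> C_group n" using C_group_comp[OF lact_C_group c(1)] by metis
  have "y n = n" using assms(2) by (simp add: S_group_def)
  then show ?thesis using C_group_eq[OF assms(1) yC] cyc_pow_period[OF assms(1)] by simp
qed

lemma sum_C_group_translate:
  assumes "2 \<le> n" "b \<in> C_group n"
  shows "(\<Sum>c\<in>C_group n. if d = b \<circ> c then 1 else 0) = (if d \<in> C_group n then 1 else (0::complex))"
proof -
  obtain b' where b': "b' \<in> C_group n" "b \<circ> b' = id" "b' \<circ> b = id"
    using C_group_inv[OF assms] by blast
  have "d = b \<circ> c \<longleftrightarrow> c = b' \<circ> d" for c
    using b'(2,3) by (metis comp_assoc id_comp)
  moreover have "b' \<circ> d \<in> C_group n \<longleftrightarrow> d \<in> C_group n"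
    using C_group_comp b' assms(2) by (metis comp_assoc id_comp)
  ultimately show ?thesis
    using finite_C_group[OF assms(1)] by simp
qed

lemma normalized_integral_exists:
  assumes "2 \<le> n"
  shows "is_normalized_integral n (\<lambda>(y, b). if y = id \<and> b \<in> C_group n then 1 / of_nat n else 0)"
    (is "is_normalized_integral n ?L")
proof -
  note fin = finite_C_group[OF assms] finite_S_group[of n]
  have counit: "J_counit n h = (\<Sum>b\<in>C_group n. h (id, b))" for h
  proof -
    have "J_counit n h = (\<Sum>y\<in>S_group n. \<Sum>b\<in>C_group n. if y = id then h (y, b) else 0)"
      unfolding J_counit_def J_index_def sum.cartesian_product by (auto intro: sum.cong)
    also have "\<dots> = (\<Sum>y\<in>S_group n. if y = id then (\<Sum>b\<in>C_group n. h (id, b)) else 0)"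
      by (auto intro: sum.cong)
    finally show ?thesis using fin id_S_group by (simp add: sum.delta')
  qed
  have split: "(\<Sum>u\<in>A \<times> B. G u) = (\<Sum>a\<in>A. \<Sum>b\<in>B. G (a, b))"
    for A B :: "perm set" and G :: jelt
    by (simp add: sum.cartesian_product)
  have mult: "J_mult n f g (w, d) = (\<Sum>y\<in>S_group n. \<Sum>b\<in>C_group n. \<Sum>z\<in>S_group n. \<Sum>c\<in>C_group n.
      if z = ract n y b \<and> w = y \<and> d = b \<circ> c then f (y, b) * g (z, c) else 0)" for f g w d
    unfolding J_mult_def J_mult_tensor_def J_index_def split
    by (intro sum.cong refl) (simp add: J_basis_mult_def J_basis_def)
  have left: "J_mult n h ?L (w, d) = J_counit n h * ?L (w, d)" for h w d
  proof -
    have "J_mult n h ?L (w, d) =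
        (\<Sum>y\<in>S_group n. if y = id then (\<Sum>b\<in>C_group n. \<Sum>z\<in>S_group n. if z = id then
           (\<Sum>c\<in>C_group n. if w = id \<and> d = b \<circ> c then h (id, b) / of_nat n else 0) else 0) else 0)"
      unfolding mult
      by (intro sum.cong refl) (auto simp: ract_id_left[OF assms] dest: ract_eq_id[OF assms] intro!: sum.cong sum.neutral)
    also have "\<dots> = (\<Sum>b\<in>C_group n. \<Sum>c\<in>C_group n.
        if w = id \<and> d = b \<circ> c then h (id, b) / of_nat n else 0)"
      using fin id_S_group by (simp add: sum.delta')
    also have "\<dots> = (\<Sum>b\<in>C_group n. h (id, b) / of_nat n * (if w = id then 1 else 0) *
        (\<Sum>c\<in>C_group n. if d = b \<circ> c then 1 else 0))"
      by (auto intro!: sum.cong simp: sum_distrib_left)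
    also have "\<dots> = (\<Sum>b\<in>C_group n. h (id, b) * ?L (w, d))"
      by (intro sum.cong refl) (simp add: sum_C_group_translate[OF assms])
    finally show ?thesis by (simp add: counit sum_distrib_right)
  qed
  have right: "J_mult n ?L h (w, d) = J_counit n h * ?L (w, d)" for h w d
  proof -
    have "J_mult n ?L h (w, d) =
        (\<Sum>y\<in>S_group n. if y = id then (\<Sum>b\<in>C_group n. \<Sum>z\<in>S_group n. if z = id then
           (\<Sum>c\<in>C_group n. if w = id \<and> d = b \<circ> c then h (id, c) / of_nat n else 0) else 0) else 0)"
      unfolding mult
      by (intro sum.cong refl) (auto simp: ract_id_left[OF assms] intro!: sum.cong sum.neutral)
    also have "\<dots> = (\<Sum>b\<in>C_group n. \<Sum>c\<in>C_group n.
        if w = id \<and> d = b \<circ> c then h (id, c) / of_nat n else 0)"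
      using fin id_S_group by (simp add: sum.delta')
    also have "\<dots> = (\<Sum>c\<in>C_group n. \<Sum>b\<in>C_group n.
        if w = id \<and> d = b \<circ> c then h (id, c) / of_nat n else 0)"
      by (rule sum.swap)
    also have "\<dots> = (\<Sum>c\<in>C_group n. \<Sum>b\<in>C_group n.
        if w = id \<and> d = c \<circ> b then h (id, c) / of_nat n else 0)"
      by (intro sum.cong refl) (metis C_group_commute)
    also have "\<dots> = (\<Sum>c\<in>C_group n. h (id, c) / of_nat n * (if w = id then 1 else 0) *
        (\<Sum>b\<in>C_group n. if d = c \<circ> b then 1 else 0))"
      by (auto intro!: sum.cong simp: sum_distrib_left)
    also have "\<dots> = (\<Sum>c\<in>C_group n. h (id, c) * ?L (w, d))"
      by (intro sum.cong refl) (simp add: sum_C_group_translate[OF assms])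
    finally show ?thesis by (simp add: counit sum_distrib_right)
  qed
  have "?L \<in> J_carrier n"
    using id_S_group by (auto simp: J_carrier_def J_index_def)
  moreover have "J_counit n ?L = 1"
    using assms by (simp add: counit card_C_group)
  moreover have "J_mult n h ?L = (\<lambda>w. J_counit n h * ?L w)" for h
    using left[of h] by (auto simp only: fun_eq_iff split_paired_all)
  moreover have "J_mult n ?L h = (\<lambda>w. J_counit n h * ?L w)" for h
    using right[of h] by (auto simp only: fun_eq_iff split_paired_all)
  ultimately show ?thesis by (simp add: is_normalized_integral_def)
qed

lemma normalized_integral_ex1:
  assumes "2 \<le> n"
  shows "\<exists>!L. is_normalized_integral n L"
proof (rule ex_ex1I)
  show "\<exists>L. is_normalized_integral n L"
    using normalized_integral_exists[OF assms] by blast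
next
  fix L M assume L: "is_normalized_integral n L" and M: "is_normalized_integral n M"
  have "L \<in> J_carrier n" "J_counit n L = 1"
    and LM: "\<And>h. h \<in> J_carrier n \<Longrightarrow> J_mult n L h = (\<lambda>w. J_counit n h * L w)"
    using L by (auto simp: is_normalized_integral_def)
  moreover have "M \<in> J_carrier n" "J_counit n M = 1"
    and "\<And>h. h \<in> J_carrier n \<Longrightarrow> J_mult n h M = (\<lambda>w. J_counit n h * M w)"
    using M by (auto simp: is_normalized_integral_def)
  ultimately have "J_mult n L M = (\<lambda>w. 1 * L w)" "J_mult n L M = (\<lambda>w. 1 * M w)"
    by metis+
  then show "L = M" by simp
qed

end

theory Submission
  imports Defs
begin

text \<open>
  The element \<open>\<Sum>\<Lambda>\<^sub>1\<Lambda>\<^sub>2\<close> is \<open>1/n\<close> times the sum over \<open>z\<close> of \<open>t\<^sub>z = \<Sum>\<^sub>b p\<^bsub>inv z\<^esub> # zbzb\<close>, where \<open>b\<close>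
  ranges over the set \<open>A\<close> of those elements of \<open>C\<^sub>n\<close> for which \<open>zbz\<close> lies in \<open>C\<^sub>n\<close>.
  Each \<open>\<kappa>(b) = zbzb\<close> lies in \<open>C\<^sub>n\<close> and commutes with \<open>z\<close>.  If \<open>n\<close> is odd and \<open>A\<close> is nonempty, \<open>\<kappa>\<close> takes
  the value 1, say at \<open>c\<close>, because \<open>C\<^sub>n\<close> has square roots.  Then \<open>\<kappa>(b) \<kappa>(b') = \<kappa>(b c\<^sup>-\<^sup>1 b')\<close>,
  and \<open>b' \<mapsto> b c\<^sup>-\<^sup>1 b'\<close> permutes \<open>A\<close>, so that \<open>t\<^sub>z\<^sup>2 = |A| t\<^sub>z\<close>.  Hence \<open>t\<^sub>z\<close> acts as a positive
  multiple of an idempotent and its trace is a nonnegative integer.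
\<close>

section \<open>Traces of idempotent maps\<close>

context vector_space
begin

text \<open>The basis chosen in \<open>trace\<close> is the same for every \<open>f\<close>, so all
  traces can be compared as diagonal sums over one basis.\<close>

lemma trace_basis:
  obtains B where "independent B" "span B = UNIV"
    "\<And>f. trace f = (\<Sum>b\<in>B. representation B (f b) b)"
proof -
  define B where "B = (SOME B. independent B \<and> span B = UNIV)"
  have "\<exists>B. independent B \<and> span B = UNIV"
    using maximal_independent_subset[of UNIV] by (metis top.extremum_uniqueI)
  then have "independent B \<and> span B = UNIV"
    unfolding B_def by (rule someI_ex)
  moreover have "trace f = (\<Sum>b\<in>B. representation B (f b) b)" for f
    by (simp add: trace_def B_def Let_def)
  ultimately show ?thesis using that by blast
qed

text \<open>Coefficients over a fixed basis are linear in the vector; over an infinite basis both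
  sides are 0.\<close>

lemma trace_sum_scale:
  assumes "finite I"
  shows "trace (\<lambda>v. \<Sum>i\<in>I. scale (a i) (f i v)) = (\<Sum>i\<in>I. a i * trace (f i))"
proof -
  obtain B where B: "independent B" "span B = UNIV"
    "\<And>f. trace f = (\<Sum>b\<in>B. representation B (f b) b)"
    by (rule trace_basis) blast
  show ?thesis
    unfolding B(3)
    by (subst sum_distrib_left, subst sum.swap)
      (simp add: representation_sum[OF B(1)] representation_scale[OF B(1)] B(2))
qed

text \<open>Expanding \<open>f b\<close> in \<open>D\<close> and each \<open>d\<close> in
  \<open>B\<close> turns both sides into the same double sum, which is tr(PQ) = tr(QP) for the two
  coefficient matrices.\<close>

lemma trace_basis_independent:
  assumes f: "Vector_Spaces.linear scale scale f"
    and B: "finite B" "independent B" "span B = UNIV"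
    and D: "finite D" "independent D" "span D = UNIV"
  shows "(\<Sum>b\<in>B. representation B (f b) b) = (\<Sum>d\<in>D. representation D (f d) d)"
proof -
  interpret f: Vector_Spaces.linear scale scale f by fact
  have expB: "(\<Sum>b\<in>B. scale (representation B v b) b) = v" for v
    using sum_representation_eq[OF B(2) _ B(1) order_refl, of v] B(3) by simp
  have expD: "(\<Sum>d\<in>D. scale (representation D v d) d) = v" for v
    using sum_representation_eq[OF D(2) _ D(1) order_refl, of v] D(3) by simp
  have "(\<Sum>b\<in>B. representation B (f b) b) =
      (\<Sum>b\<in>B. representation B (\<Sum>d\<in>D. scale (representation D (f b) d) d) b)"
    by (simp only: expD)
  also have "\<dots> = (\<Sum>b\<in>B. \<Sum>d\<in>D. representation D (f b) d * representation B d b)"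
    by (simp add: representation_sum[OF B(2)] representation_scale[OF B(2)] B(3))
  also have "\<dots> = (\<Sum>d\<in>D. \<Sum>b\<in>B. representation B d b * representation D (f b) d)"
    by (subst sum.swap) (simp add: mult.commute)
  also have "\<dots> = (\<Sum>d\<in>D. representation D (f (\<Sum>b\<in>B. scale (representation B d b) b)) d)"
    by (simp add: f.sum f.scale representation_sum[OF D(2)] representation_scale[OF D(2)] D(3))
  also have "\<dots> = (\<Sum>d\<in>D. representation D (f d) d)"
    by (simp only: expB)
  finally show ?thesis .
qed

text \<open>An idempotent is the identity on its range. In finite dimension, over a basis extending
  one of the range, its diagonal entries are 1 on the range part and 0 elsewhere, so the trace is
  the rank.\<close>

lemma trace_idempotent:
  assumes f: "Vector_Spaces.linear scale scale f" and idem: "\<And>v. f (f v) = f v"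
  shows "\<exists>k. trace f = of_nat k"
proof -
  interpret f: Vector_Spaces.linear scale scale f by fact
  obtain B where B: "independent B" "span B = UNIV"
    "\<And>f. trace f = (\<Sum>b\<in>B. representation B (f b) b)"
    by (rule trace_basis) blast
  show ?thesis
  proof (cases "finite B")
    case False
    \<comment> \<open>In infinite dimension \<^const>\<open>trace\<close> is a sum over an infinite set, hence 0.\<close>
    then show ?thesis by (intro exI[of _ 0]) (simp add: B(3))
  next
    case True
    obtain R where R: "R \<subseteq> range f" "independent R" "range f \<subseteq> span R"
      using maximal_independent_subset[of "range f"] by blast
    define D where "D = extend_basis R"
    have D: "R \<subseteq> D" "independent D" "span D = UNIV"
      unfolding D_def using extend_basis_superset[OF R(2)] independent_extend_basis[OF R(2)]
        span_extend_basis[OF R(2)] by auto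
    have "finite D"
      using independent_span_bound[OF True D(2)] B(2) by simp
    have fix_R: "f d = d" if "d \<in> R" for d
      using R(1) that idem by auto
    have "representation D (f d) d = (if d \<in> R then 1 else 0)" if "d \<in> D" for d
    proof (cases "d \<in> R")
      case True
      then show ?thesis
        using that D(2) by (simp add: fix_R representation_basis)
    next
      case False
      \<comment> \<open>Coefficients over \<open>D\<close> of a vector in the span of
        \<open>R\<close> vanish outside \<open>R\<close>, so \<open>d\<close> does not occur in
        \<open>f d\<close>.\<close>
      have "f d \<in> span R" using R(3) by auto
      then have "representation D (f d) = representation R (f d)"
        using representation_extend[OF D(2) _ D(1)] by simp
      moreover have "representation R (f d) d = 0"
        using False representation_ne_zero by metis
      ultimately show ?thesis using False by simp
    qed
    then have "(\<Sum>d\<in>D. representation D (f d) d) = (\<Sum>d\<in>D. if d \<in> R then 1 else 0)"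
      by (intro sum.cong) auto
    also have "\<dots> = of_nat (card R)"
      using \<open>finite D\<close> D(1) by (simp add: sum.If_cases Int_absorb1)
    finally have "trace f = of_nat (card R)"
      unfolding B(3) trace_basis_independent[OF f True B(1,2) \<open>finite D\<close> D(2,3)] .
    then show ?thesis ..
  qed
qed

end

text \<open>Dividing \<open>f\<close> by \<open>m\<close> gives an idempotent, so the trace of
  \<open>f\<close> is \<open>m\<close> times a natural number.\<close>

lemma trace_quasi_idempotent:
  fixes scale :: "complex \<Rightarrow> 'v \<Rightarrow> 'v::ab_group_add"
  assumes lin: "Vector_Spaces.linear scale scale f"
    and quasi: "\<And>v. f (f v) = scale (of_nat m) (f v)" and "m > 0"
  shows "vector_space.trace scale f \<in> \<real>" "Re (vector_space.trace scale f) \<ge> 0"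
proof -
  interpret f: Vector_Spaces.linear scale scale f by fact
  interpret endo: vector_space_pair scale scale ..
  define g where "g v = scale (1 / of_nat m) (f v)" for v
  have "Vector_Spaces.linear scale scale g"
    unfolding g_def by (rule endo.linear_compose_scale_right[OF lin])
  moreover have "g (g v) = g v" for v
    using \<open>m > 0\<close> by (simp add: g_def f.scale quasi)
  ultimately obtain k where k: "f.vs1.trace g = of_nat k"
    using f.vs1.trace_idempotent by blast
  \<comment> \<open>A one-element index set turns linearity of the trace into homogeneity.\<close>
  have "f.vs1.trace g = (1 / of_nat m) * f.vs1.trace f"
    using f.vs1.trace_sum_scale[of "{()}" "\<lambda>_. 1 / of_nat m" "\<lambda>_. f"]
    by (simp add: g_def[abs_def])
  then have "f.vs1.trace f = of_nat (m * k)"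
    using k \<open>m > 0\<close> by (simp add: field_simps)
  then show "f.vs1.trace f \<in> \<real>" "Re (f.vs1.trace f) \<ge> 0"
    by (metis Reals_of_nat, metis complex_Re_of_nat of_nat_0_le_iff)
qed

section \<open>Elements b of the cyclic group for which zbz is again cyclic\<close>

lemma inv_S_group: "z \<in> S_group n \<Longrightarrow> inv z \<in> S_group n"
  unfolding S_group_def by (auto simp: permutes_inv permutes_inv_eq)

lemma C_group_pow: "g \<in> C_group n \<Longrightarrow> g ^^ k \<in> C_group n"
  by (induction k) (auto simp: id_C_group C_group_comp simp flip: id_def)

lemma C_group_period:
  assumes "2 \<le> n" "g \<in> C_group n"
  shows "g ^^ n = id"
proof -
  obtain r where "g = cyc n ^^ r" using assms(2) by (auto simp: C_group_def)
  then have "g ^^ n = (cyc n ^^ n) ^^ r"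
    by (simp add: funpow_mult mult.commute)
  then show ?thesis by (simp add: cyc_pow_period[OF assms(1)])
qed

text \<open>
  By the lemma below, \<open>twist_set n z\<close> consists of the \<open>b\<close> for which \<open>z \<lhd> b = z\<^sup>-\<^sup>1\<close>,
  and then \<open>z \<rhd> b = zbz\<close>.
\<close>

definition twist_set :: "nat \<Rightarrow> perm \<Rightarrow> perm set" where
  "twist_set n z = {b \<in> C_group n. z \<circ> b \<circ> z \<in> C_group n}"

text \<open>The equation is the condition for the basis elements indexed by
  \<open>(inv z, lact n z b)\<close> and \<open>(z, b)\<close>, the two factors of a term of the
  coproduct, to have a nonzero product. On \<open>twist_set n z\<close> the factorisation of
  \<open>zb\<close> is \<open>zbz\<close> times \<open>inv z\<close>.\<close>

lemma lact_twist_set: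
  assumes "2 \<le> n" "z \<in> S_group n" "b \<in> C_group n"
  shows "z = ract n (inv z) (lact n z b) \<longleftrightarrow> b \<in> twist_set n z"
    and "b \<in> twist_set n z \<Longrightarrow> lact n z b = z \<circ> b \<circ> z"
proof -
  have zi: "z \<circ> inv z = id" "inv z \<circ> z = id"
    using assms(2) by (auto simp: S_group_def permutes_inv_o)
  define c where "c = lact n z b"
  show l: "lact n z b = z \<circ> b \<circ> z" if "b \<in> twist_set n z"
    using factorisation_unique(1)[of n "z \<circ> b \<circ> z" "inv z" z b] that assms(1) inv_S_group[OF assms(2)] zi
    by (simp add: twist_set_def comp_assoc)
  show "z = ract n (inv z) (lact n z b) \<longleftrightarrow> b \<in> twist_set n z"
  proof
    assume "b \<in> twist_set n z"
    then show "z = ract n (inv z) (lact n z b)"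
      using factorisation_unique(2)[of n b z "inv z" "lact n z b"] assms zi
      by (simp add: l comp_assoc[symmetric])
  next
    assume eq: "z = ract n (inv z) (lact n z b)"
    define r where "r = ract n z b"
    have r: "z \<circ> b = c \<circ> r" "r \<in> S_group n"
      using factorisation[OF assms(1)] ract_S_group[OF assms] by (simp_all add: r_def c_def)
    then have ri: "r \<circ> inv r = id"
      by (auto simp: S_group_def permutes_inv_o)
    \<comment> \<open>Rearranging \<open>z \<circ> b = c \<circ> r\<close> yields the factorisation
      of \<open>inv z \<circ> c\<close>. By \<open>eq\<close> its second component is
      \<open>z\<close>, whence \<open>inv r = z\<close>.\<close>
    have "inv z \<circ> c = b \<circ> inv r"
    proof -
      have "inv z \<circ> c = inv z \<circ> (c \<circ> r) \<circ> inv r" using ri by (simp add: comp_assoc)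
      also have "\<dots> = b \<circ> inv r" using zi by (simp add: comp_assoc[symmetric] flip: r(1))
      finally show ?thesis .
    qed
    then have "inv r = ract n (inv z) c"
      using factorisation_unique(2)[of n b "inv r" "inv z" c] assms inv_S_group[OF r(2)] by simp
    then have "inv r = z" using eq by (simp add: c_def)
    then have "z \<circ> b \<circ> z = c" using ri r(1) by (simp add: comp_assoc)
    then show "b \<in> twist_set n z"
      using assms(3) lact_C_group by (simp add: twist_set_def c_def)
  qed
qed

text \<open>Since \<open>b\<close> and \<open>zbz\<close> lie in the abelian
  \<open>C_group n\<close>, \<open>z(zbz)b\<close> equals \<open>zb(zbz)\<close>, which is
  \<open>(zbzb)z\<close>.\<close>

lemma twist_commute:
  assumes "b \<in> twist_set n z"
  shows "z \<circ> (z \<circ> b \<circ> z \<circ> b) = (z \<circ> b \<circ> z \<circ> b) \<circ> z"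
proof -
  have "(z \<circ> b \<circ> z) \<circ> b = b \<circ> (z \<circ> b \<circ> z)"
    using assms C_group_commute by (auto simp: twist_set_def)
  then show ?thesis by (metis comp_assoc)
qed

text \<open>
  The element \<open>g = zbzb\<close> of the odd cyclic group commutes with \<open>z\<close>, so \<open>b\<close> can be corrected
  by the inverse square root of \<open>g\<close>.
\<close>

lemma twist_set_involution:
  assumes "2 \<le> n" "odd n" "b \<in> twist_set n z"
  shows "\<exists>c\<in>twist_set n z. z \<circ> c \<circ> z \<circ> c = id"
proof -
  have b: "b \<in> C_group n" "z \<circ> b \<circ> z \<in> C_group n" using assms(3) by (auto simp: twist_set_def)
  define g where "g = z \<circ> b \<circ> z \<circ> b"
  have g: "g \<in> C_group n" "z \<circ> g = g \<circ> z"
    using C_group_comp[OF b(2,1)] twist_commute[OF assms(3)] by (simp_all add: g_def)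
  obtain k where k: "n = Suc (k + k)" using assms(2) by (auto elim!: oddE simp: mult_2)
  \<comment> \<open>As \<open>n = 2k + 1\<close>, this is an inverse square root of
    \<open>g\<close>: \<open>h \<circ> h \<circ> g\<close> is \<open>g ^^ n\<close>, the
    identity.\<close>
  define h where "h = g ^^ k"
  have h: "h \<in> C_group n" using C_group_pow[OF g(1)] by (simp add: h_def)
  have "z \<circ> g ^^ j = g ^^ j \<circ> z" for j
  proof (induction j)
    case (Suc j)
    have "z \<circ> g ^^ Suc j = (g \<circ> z) \<circ> g ^^ j" by (simp add: comp_assoc flip: g(2))
    also have "\<dots> = g ^^ Suc j \<circ> z" by (simp only: comp_assoc Suc funpow.simps)
    finally show ?case .
  qed simp
  then have zh: "z \<circ> h = h \<circ> z" by (simp add: h_def)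
  have "g \<circ> (h \<circ> h) = id"
    using C_group_period[OF assms(1) g(1)] by (simp add: k h_def flip: funpow_add)
  then have hhg: "h \<circ> (h \<circ> g) = id"
    using C_group_commute[OF g(1) C_group_comp[OF h h]] by (simp add: comp_assoc)
  define c where "c = h \<circ> b"
  have zcz: "z \<circ> c \<circ> z = h \<circ> (z \<circ> b \<circ> z)"
    by (simp add: c_def zh flip: comp_assoc)
  \<comment> \<open>Correcting \<open>b\<close> by \<open>h\<close> multiplies \<open>zbzb\<close>
    by \<open>h \<circ> h\<close>, because \<open>h\<close> commutes with \<open>z\<close> and with
    \<open>C_group n\<close>.\<close>
  have "z \<circ> c \<circ> z \<circ> c = h \<circ> (z \<circ> b \<circ> z \<circ> h) \<circ> b"
    by (simp only: zcz) (simp add: c_def comp_assoc)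
  also have "\<dots> = h \<circ> (h \<circ> (z \<circ> b \<circ> z)) \<circ> b"
    using C_group_commute[OF b(2) h] by simp
  also have "\<dots> = id" using hhg by (simp add: g_def comp_assoc)
  finally show ?thesis
    using C_group_comp[OF h b(1)] C_group_comp[OF h b(2)] zcz
    by (intro bexI[of _ c]) (auto simp: twist_set_def c_def)
qed

text \<open>Here \<open>d\<close> is the inverse of \<open>c\<close>. Writing it as
  \<open>zcz\<close> gives \<open>z(bdb')z = (zbz)c(zb'z)\<close>, a product inside the abelian
  \<open>C_group n\<close>; in the full product \<open>c\<close> and \<open>d\<close> then
  cancel.\<close>

lemma twist_set_product:
  assumes "d \<in> C_group n" "c \<in> C_group n" "c \<circ> d = id" "z \<circ> c \<circ> z = d"
    and b: "b \<in> twist_set n z" "b' \<in> twist_set n z"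
  shows "b \<circ> d \<circ> b' \<in> twist_set n z"
    and "z \<circ> (b \<circ> d \<circ> b') \<circ> z \<circ> (b \<circ> d \<circ> b') = (z \<circ> b \<circ> z \<circ> b) \<circ> (z \<circ> b' \<circ> z \<circ> b')"
proof -
  have bC: "b \<in> C_group n" "b' \<in> C_group n"
    "z \<circ> b \<circ> z \<in> C_group n" "z \<circ> b' \<circ> z \<in> C_group n"
    using b by (auto simp: twist_set_def)
  have d: "d = z \<circ> (c \<circ> z)" using assms(4) by (simp add: comp_assoc)
  have eq: "z \<circ> (b \<circ> d \<circ> b') \<circ> z = (z \<circ> b \<circ> z) \<circ> c \<circ> (z \<circ> b' \<circ> z)"
    by (simp add: d comp_assoc)
  then show "b \<circ> d \<circ> b' \<in> twist_set n z"
    using bC assms(1,2) by (simp add: twist_set_def C_group_comp)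
  define e where "e = z \<circ> b \<circ> z"
  define e' where "e' = z \<circ> b' \<circ> z"
  have comm: "x (y i) = y (x i)" if "x \<in> C_group n" "y \<in> C_group n" for x y i
    using C_group_commute[OF that] by (metis comp_apply)
  have cd: "c (d i) = i" for i using assms(3) by (metis comp_apply id_apply)
  have "e \<circ> c \<circ> e' \<circ> (b \<circ> d \<circ> b') = e \<circ> b \<circ> (e' \<circ> b')"
  proof
    fix i
    have "(e \<circ> c \<circ> e' \<circ> (b \<circ> d \<circ> b')) i = e (c (e' (b (d (b' i)))))" by simp
    also have "\<dots> = e (e' (b (c (d (b' i)))))"
      using bC(1,4) assms(2) unfolding e'_def[symmetric] by (metis comm)
    also have "\<dots> = e (b (e' (b' i)))"
      using bC(1,4) unfolding e'_def[symmetric] by (metis comm cd)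
    finally show "(e \<circ> c \<circ> e' \<circ> (b \<circ> d \<circ> b')) i = (e \<circ> b \<circ> (e' \<circ> b')) i" by simp
  qed
  then show "z \<circ> (b \<circ> d \<circ> b') \<circ> z \<circ> (b \<circ> d \<circ> b') = (z \<circ> b \<circ> z \<circ> b) \<circ> (z \<circ> b' \<circ> z \<circ> b')"
    unfolding eq e_def e'_def .
qed

section \<open>Multiplying out the coproduct of the integral\<close>

lemma finite_J_index: "2 \<le> n \<Longrightarrow> finite (J_index n)"
  by (simp add: J_index_def finite_S_group finite_C_group)

lemma J_basis_carrier: "u \<in> J_index n \<Longrightarrow> J_basis u \<in> J_carrier n"
  by (auto simp: J_carrier_def J_basis_def)

lemma J_mult_tensor_sum:
  "J_mult_tensor n (\<lambda>p. \<Sum>i\<in>I. a i * t i p) = (\<lambda>w. \<Sum>i\<in>I. a i * J_mult_tensor n (t i) w)"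
  unfolding J_mult_tensor_def sum_distrib_right sum_distrib_left mult.assoc
  by (simp only: sum.swap[of _ I "J_index n"])

lemma J_mult_tensor_basis:
  assumes "2 \<le> n" "u \<in> J_index n" "v \<in> J_index n"
  shows "J_mult_tensor n (\<lambda>(u', v'). J_basis u u' * J_basis v v') = J_basis_mult n u v"
proof
  fix w
  have "J_mult_tensor n (\<lambda>(u', v'). J_basis u u' * J_basis v v') w =
    (\<Sum>u'\<in>J_index n. if u' = u then \<Sum>v'\<in>J_index n. if v' = v then J_basis_mult n u v w else 0 else 0)"
    unfolding J_mult_tensor_def J_basis_def by (intro sum.cong refl) (auto intro!: sum.cong)
  then show "J_mult_tensor n (\<lambda>(u', v'). J_basis u u' * J_basis v v') w = J_basis_mult n u v w"
    using assms by (simp add: finite_J_index sum.delta')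
qed

lemma J_integral_eq:
  assumes "2 \<le> n"
  shows "J_integral n = (\<lambda>(y, b). if y = id \<and> b \<in> C_group n then 1 / of_nat n else 0)"
  unfolding J_integral_def
  by (intro the1_equality normalized_integral_ex1 normalized_integral_exists assms)

lemma J_comult_integral:
  assumes "2 \<le> n"
  shows "J_comult n (J_integral n) = (\<lambda>p. \<Sum>(z, b)\<in>S_group n \<times> C_group n.
    1 / of_nat n * (case p of (u, v) \<Rightarrow> J_basis (inv z, lact n z b) u * J_basis (z, b) v))"
proof
  fix p :: "jidx \<times> jidx"
  obtain u v where p: "p = (u, v)" by (cases p)
  let ?G = "\<lambda>y b. \<Sum>z\<in>S_group n. J_basis (y \<circ> inv z, lact n z b) u * J_basis (z, b) v"
  have "J_comult n (J_integral n) p =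
      (\<Sum>y\<in>S_group n. \<Sum>b\<in>C_group n. (if y = id then 1 / of_nat n else 0) * ?G y b)"
    unfolding J_comult_def J_integral_eq[OF assms] p J_index_def sum.cartesian_product
    by (auto intro!: sum.cong)
  \<comment> \<open>Only \<open>y = id\<close> survives, so \<open>y \<circ> inv z\<close> becomes
    \<open>inv z\<close>.\<close>
  also have "\<dots> = (\<Sum>y\<in>S_group n. if y = id then \<Sum>b\<in>C_group n. 1 / of_nat n * ?G id b else 0)"
    by (intro sum.cong refl) auto
  also have "\<dots> = (\<Sum>b\<in>C_group n. 1 / of_nat n * ?G id b)"
    using id_S_group[of n] finite_S_group[of n] by (simp add: sum.delta')
  also have "\<dots> = (\<Sum>z\<in>S_group n. \<Sum>b\<in>C_group n.
      1 / of_nat n * (J_basis (inv z, lact n z b) u * J_basis (z, b) v))"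
    unfolding sum_distrib_left by (subst sum.swap) simp
  finally show "J_comult n (J_integral n) p = (\<Sum>(z, b)\<in>S_group n \<times> C_group n.
    1 / of_nat n * (case p of (u, v) \<Rightarrow> J_basis (inv z, lact n z b) u * J_basis (z, b) v))"
    by (simp add: sum.cartesian_product p)
qed

text \<open>The two factors of the coproduct term for \<open>(z, b)\<close> multiply to 0 unless
  \<open>b\<close> lies in \<open>twist_set n z\<close>; then their cyclic components
  \<open>zbz\<close> and \<open>b\<close> multiply to \<open>zbzb\<close>.\<close>

lemma integral_square:
  assumes "2 \<le> n"
  shows "J_mult_tensor n (J_comult n (J_integral n)) =
    (\<lambda>w. \<Sum>(z, b)\<in>Sigma (S_group n) (twist_set n).
       1 / of_nat n * J_basis (inv z, z \<circ> b \<circ> z \<circ> b) w)"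
proof
  fix w
  have fin: "finite (S_group n \<times> C_group n)"
    using finite_J_index[OF assms] by (simp add: J_index_def)
  have "J_mult_tensor n (J_comult n (J_integral n)) w = (\<Sum>(z, b)\<in>S_group n \<times> C_group n.
      1 / of_nat n * J_mult_tensor n
        (\<lambda>(u, v). J_basis (inv z, lact n z b) u * J_basis (z, b) v) w)"
    unfolding J_comult_integral[OF assms]
    using fun_cong[OF J_mult_tensor_sum[of n "\<lambda>_. 1 / of_nat n"
      "\<lambda>(z, b) p. case p of (u, v) \<Rightarrow> J_basis (inv z, lact n z b) u * J_basis (z, b) v"
      "S_group n \<times> C_group n"], of w]
    by (simp add: case_prod_unfold)
  also have "\<dots> = (\<Sum>(z, b)\<in>S_group n \<times> C_group n. if b \<in> twist_set n z then
      1 / of_nat n * J_basis (inv z, z \<circ> b \<circ> z \<circ> b) w else 0)"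
  proof (intro sum.cong refl, clarify)
    fix z b assume zb: "z \<in> S_group n" "b \<in> C_group n"
    have "J_mult_tensor n (\<lambda>(u, v). J_basis (inv z, lact n z b) u * J_basis (z, b) v) =
        J_basis_mult n (inv z, lact n z b) (z, b)"
      using zb by (intro J_mult_tensor_basis[OF assms]) (auto simp: J_index_def inv_S_group lact_C_group)
    then show "1 / of_nat n * J_mult_tensor n
        (\<lambda>(u, v). J_basis (inv z, lact n z b) u * J_basis (z, b) v) w =
        (if b \<in> twist_set n z then 1 / of_nat n * J_basis (inv z, z \<circ> b \<circ> z \<circ> b) w else 0)"
      using lact_twist_set[OF assms zb] by (simp add: J_basis_mult_def)
  qed
  also have "\<dots> = (\<Sum>p\<in>{p \<in> S_group n \<times> C_group n. snd p \<in> twist_set n (fst p)}.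
      case p of (z, b) \<Rightarrow> 1 / of_nat n * J_basis (inv z, z \<circ> b \<circ> z \<circ> b) w)"
    using sum.inter_filter[OF fin, of "\<lambda>(z, b). 1 / of_nat n * J_basis (inv z, z \<circ> b \<circ> z \<circ> b) w"
      "\<lambda>p. snd p \<in> twist_set n (fst p)"] by (simp only: case_prod_unfold)
  also have "{p \<in> S_group n \<times> C_group n. snd p \<in> twist_set n (fst p)} = Sigma (S_group n) (twist_set n)"
    by (auto simp: twist_set_def)
  finally show "J_mult_tensor n (J_comult n (J_integral n)) w =
      (\<Sum>(z, b)\<in>Sigma (S_group n) (twist_set n). 1 / of_nat n * J_basis (inv z, z \<circ> b \<circ> z \<circ> b) w)" .
qed

text \<open>The equation \<open>x \<circ> k = k \<circ> x\<close> is already the factorisation of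
  \<open>x \<circ> k\<close>, so \<open>ract\<close> leaves \<open>x\<close> fixed and the delta in
  the product is 1.\<close>

lemma J_mult_basis_commuting:
  assumes "2 \<le> n" "x \<in> S_group n" "k \<in> C_group n" "l \<in> C_group n" "x \<circ> k = k \<circ> x"
  shows "J_mult n (J_basis (x, k)) (J_basis (x, l)) = J_basis (x, k \<circ> l)"
proof -
  have "ract n x k = x"
    using factorisation_unique(2)[OF assms(1,3,2,5)] by simp
  moreover have "J_mult n (J_basis (x, k)) (J_basis (x, l)) = J_basis_mult n (x, k) (x, l)"
    unfolding J_mult_def using assms by (intro J_mult_tensor_basis) (auto simp: J_index_def)
  ultimately show ?thesis by (simp add: J_basis_mult_def)
qed

section \<open>The action on modules and the sign of the indicator\<close>

lemma J_module_act_sum: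
  fixes scale :: "complex \<Rightarrow> 'v \<Rightarrow> 'v::ab_group_add"
  assumes "J_module n scale act" "finite I" "\<And>i. i \<in> I \<Longrightarrow> h i \<in> J_carrier n"
  shows "act (\<lambda>w. \<Sum>i\<in>I. a i * h i w) v = (\<Sum>i\<in>I. scale (a i) (act (h i) v))"
  using assms(2,3)
proof (induction I rule: finite_induct)
  case empty
  interpret vector_space scale using assms(1) by (simp add: J_module_def)
  have "(\<lambda>_. 0) \<in> J_carrier n" by (simp add: J_carrier_def)
  \<comment> \<open>The zero function is 0 times a carrier element, so homogeneity makes it act as
    0.\<close>
  moreover have "act (\<lambda>w. 0 * h w) v = scale 0 (act h v)" if "h \<in> J_carrier n" for h
    using assms(1) that unfolding J_module_def by blast
  ultimately show ?case by fastforce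
next
  case (insert j I)
  have add: "act (\<lambda>w. f w + g w) v = act f v + act g v"
    if "f \<in> J_carrier n" "g \<in> J_carrier n" for f g
    using assms(1) that unfolding J_module_def by blast
  have "(\<lambda>w. a j * h j w) \<in> J_carrier n" "(\<lambda>w. \<Sum>i\<in>I. a i * h i w) \<in> J_carrier n"
    using insert.prems by (auto simp: J_carrier_def)
  then have "act (\<lambda>w. a j * h j w + (\<Sum>i\<in>I. a i * h i w)) v =
      act (\<lambda>w. a j * h j w) v + act (\<lambda>w. \<Sum>i\<in>I. a i * h i w) v"
    by (rule add)
  moreover have "act (\<lambda>w. a j * h j w) v = scale (a j) (act (h j) v)"
    using assms(1) insert.prems unfolding J_module_def by blast
  ultimately show ?case using insert by simp
qed

lemma twist_sum_quasi_idempotent: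
  fixes scale :: "complex \<Rightarrow> 'v \<Rightarrow> 'v::ab_group_add"
  assumes "2 \<le> n" "odd n" and M: "J_module n scale act" and z: "z \<in> S_group n"
  defines "T \<equiv> \<lambda>v. \<Sum>b\<in>twist_set n z. act (J_basis (inv z, z \<circ> b \<circ> z \<circ> b)) v"
  assumes "b\<^sub>0 \<in> twist_set n z"
  shows "T (T v) = scale (of_nat (card (twist_set n z))) (T v)"
proof -
  interpret vector_space scale using M by (simp add: J_module_def)
  let ?A = "twist_set n z"
  let ?\<kappa> = "\<lambda>b. z \<circ> b \<circ> z \<circ> b"
  obtain c where c: "c \<in> ?A" "z \<circ> c \<circ> z \<circ> c = id"
    using twist_set_involution[OF assms(1,2,6)] by blast
  then have cC: "c \<in> C_group n" by (simp add: twist_set_def)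
  \<comment> \<open>Since \<open>zczc = id\<close>, \<open>d\<close> is the inverse of
    \<open>c\<close>, and \<open>b \<circ> d \<circ> b'\<close> defines a product on the twist set
    with identity \<open>c\<close>.\<close>
  define d where "d = z \<circ> c \<circ> z"
  have d: "d \<in> C_group n" "d \<circ> c = id" using c by (auto simp: twist_set_def d_def)
  then have cd: "c \<circ> d = id" using C_group_commute[OF cC d(1)] by simp
  note product = twist_set_product[OF d(1) cC cd d_def[symmetric]]
  have finA: "finite ?A" using finite_C_group[OF assms(1)] by (simp add: twist_set_def)
  have kC: "?\<kappa> b \<in> C_group n" if "b \<in> ?A" for b
    using that C_group_comp[of "z \<circ> b \<circ> z" n b] by (simp add: twist_set_def)
  have zi: "z \<circ> inv z = id" "inv z \<circ> z = id"
    using z by (auto simp: S_group_def permutes_inv_o)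
  \<comment> \<open>Commutation passes from \<open>z\<close> to \<open>inv z\<close>; it makes basis
    elements with the common first index \<open>inv z\<close> multiply through their cyclic
    components.\<close>
  have comm: "inv z \<circ> ?\<kappa> b = ?\<kappa> b \<circ> inv z" if "b \<in> ?A" for b
  proof -
    have "inv z \<circ> ?\<kappa> b = inv z \<circ> (?\<kappa> b \<circ> z) \<circ> inv z" using zi by (simp add: comp_assoc)
    also have "\<dots> = inv z \<circ> (z \<circ> ?\<kappa> b) \<circ> inv z" by (simp only: twist_commute[OF that])
    also have "\<dots> = (inv z \<circ> z) \<circ> ?\<kappa> b \<circ> inv z" by (simp only: comp_assoc)
    finally show ?thesis by (simp only: zi id_comp)
  qed
  have car: "J_basis (inv z, ?\<kappa> b) \<in> J_carrier n" if "b \<in> ?A" for b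
    using kC[OF that] inv_S_group[OF z] by (intro J_basis_carrier) (simp add: J_index_def)
  have lin: "Vector_Spaces.linear scale scale (act (J_basis (inv z, ?\<kappa> b)))" if "b \<in> ?A" for b
    using M car[OF that] by (simp add: J_module_def)
  have act_sum: "act (J_basis (inv z, ?\<kappa> b)) (\<Sum>i\<in>?A. g i) =
      (\<Sum>i\<in>?A. act (J_basis (inv z, ?\<kappa> b)) (g i))"
    if "b \<in> ?A" for b g
  proof -
    interpret m: Vector_Spaces.linear scale scale "act (J_basis (inv z, ?\<kappa> b))"
      by (rule lin[OF that])
    show ?thesis by (rule m.sum)
  qed
  have act_act: "act (J_basis (inv z, ?\<kappa> b)) (act (J_basis (inv z, ?\<kappa> b')) v) =
      act (J_basis (inv z, ?\<kappa> (b \<circ> d \<circ> b'))) v" if b: "b \<in> ?A" "b' \<in> ?A" for b b'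
  proof -
    have "act (J_mult n (J_basis (inv z, ?\<kappa> b)) (J_basis (inv z, ?\<kappa> b'))) v =
      act (J_basis (inv z, ?\<kappa> b)) (act (J_basis (inv z, ?\<kappa> b')) v)"
      using M car b unfolding J_module_def by blast
    then show ?thesis
      using J_mult_basis_commuting[OF assms(1) inv_S_group[OF z] kC[OF b(1)] kC[OF b(2)] comm[OF b(1)]]
        product(2)[OF b] by simp
  qed
  have bij: "bij_betw (\<lambda>b'. b \<circ> d \<circ> b') ?A ?A" if b: "b \<in> ?A" for b
  proof -
    have "b \<circ> d \<in> C_group n" using b d(1) by (simp add: twist_set_def C_group_comp)
    \<comment> \<open>The left inverse \<open>e\<close> gives injectivity, and finiteness of
      \<open>?A\<close> then makes this self-map surjective.\<close>
    then obtain e where "e \<circ> (b \<circ> d) = id" using C_group_inv[OF assms(1)] by blast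
    then have "inj_on (\<lambda>b'. b \<circ> d \<circ> b') ?A"
      by (intro inj_on_inverseI[of _ "\<lambda>x. e \<circ> x"]) (metis comp_assoc id_comp)
    moreover have "(\<lambda>b'. b \<circ> d \<circ> b') ` ?A \<subseteq> ?A" using product(1)[OF b] by blast
    ultimately show ?thesis using finA by (simp add: bij_betw_def endo_inj_surj)
  qed
  have "T (T v) = (\<Sum>b\<in>?A. \<Sum>b'\<in>?A.
      act (J_basis (inv z, ?\<kappa> b)) (act (J_basis (inv z, ?\<kappa> b')) v))"
    unfolding T_def by (intro sum.cong refl act_sum)
  also have "\<dots> = (\<Sum>b\<in>?A. \<Sum>b'\<in>?A. act (J_basis (inv z, ?\<kappa> (b \<circ> d \<circ> b'))) v)"
    by (intro sum.cong refl act_act)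
  \<comment> \<open>By \<open>bij\<close>, each inner sum is a rearrangement of
    \<open>T v\<close>.\<close>
  also have "\<dots> = (\<Sum>b\<in>?A. T v)"
    unfolding T_def
    by (intro sum.cong refl sum.reindex_bij_betw[OF bij, of _ "\<lambda>x. act (J_basis (inv z, ?\<kappa> x)) v"])
  finally show ?thesis by (simp add: sum_constant_scale)
qed

theorem corollary4p3p3:
  fixes n :: nat
    and scale :: "complex \<Rightarrow> 'v \<Rightarrow> 'v::ab_group_add"
    and act :: "jelt \<Rightarrow> 'v \<Rightarrow> 'v"
  assumes "n \<ge> 2" and "odd n"
    and "irreducible_J_module n scale act"
  shows "FS_indicator n (J_character scale act) \<in> \<real> \<and>
         Re (FS_indicator n (J_character scale act)) \<ge> 0"
proof -
  have M: "J_module n scale act" using assms(3) by (simp add: irreducible_J_module_def)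
  interpret vector_space scale using M by (simp add: J_module_def)
  interpret endo: vector_space_pair scale scale ..
  let ?\<Sigma> = "Sigma (S_group n) (twist_set n)"
  define m where "m = (\<lambda>(z, b). J_basis (inv z, z \<circ> b \<circ> z \<circ> b))"
  \<comment> \<open>\<open>T z\<close> is \<open>n\<close> times the contribution of
    \<open>z\<close> to the operator whose trace is the indicator.\<close>
  define T where "T z v = (\<Sum>b\<in>twist_set n z. act (m (z, b)) v)" for z v
  have finA: "finite (twist_set n z)" for z
    using finite_C_group[OF assms(1)] by (simp add: twist_set_def)
  have fin: "finite ?\<Sigma>" using finite_S_group finA by blast
  have car: "m p \<in> J_carrier n" if p\<Sigma>: "p \<in> ?\<Sigma>" for p
  proof -
    obtain z b where p: "p = (z, b)" "z \<in> S_group n" "b \<in> twist_set n z" using p\<Sigma> by (rule SigmaE)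
    then have "z \<circ> b \<circ> z \<circ> b \<in> C_group n"
      using C_group_comp[of "z \<circ> b \<circ> z" n b] by (simp add: twist_set_def)
    then show ?thesis using p inv_S_group by (auto simp: m_def J_index_def intro!: J_basis_carrier)
  qed
  have "act (J_mult_tensor n (J_comult n (J_integral n))) =
      (\<lambda>v. \<Sum>p\<in>?\<Sigma>. scale (1 / of_nat n) (act (m p) v))"
    using J_module_act_sum[OF M fin car, where a = "\<lambda>_. 1 / of_nat n"]
    unfolding integral_square[OF assms(1)] by (auto simp: m_def case_prod_unfold)
  also have "\<dots> = (\<lambda>v. \<Sum>z\<in>S_group n. scale (1 / of_nat n) (T z v))"
    unfolding T_def scale_sum_right
    by (simp add: sum.Sigma finite_S_group finA)
  finally have FS: "FS_indicator n (J_character scale act) =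
      (\<Sum>z\<in>S_group n. 1 / of_nat n * trace (T z))"
    unfolding FS_indicator_def J_character_def
    by (simp only: trace_sum_scale[OF finite_S_group])
  have T: "trace (T z) \<in> \<real> \<and> 0 \<le> Re (trace (T z))" if z: "z \<in> S_group n" for z
  proof (cases "twist_set n z = {}")
    case True
    \<comment> \<open>Here \<open>T z\<close> is an empty sum, and linearity of the trace over the
      empty index set gives 0.\<close>
    then show ?thesis
      using trace_sum_scale[of "{}" "\<lambda>_. 1" "\<lambda>_. id"] by (simp add: T_def[abs_def])
  next
    case False
    then obtain b\<^sub>0 where "b\<^sub>0 \<in> twist_set n z" by blast
    then have "T z (T z v) = scale (of_nat (card (twist_set n z))) (T z v)" for v
      using twist_sum_quasi_idempotent[OF assms(1,2) M z] by (simp add: T_def m_def)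
    moreover have "Vector_Spaces.linear scale scale (T z)"
      unfolding T_def[abs_def] using M car z
      by (intro endo.linear_compose_sum ballI) (auto simp: J_module_def)
    moreover have "card (twist_set n z) > 0" using False finA by (simp add: card_gt_0_iff)
    ultimately show ?thesis using trace_quasi_idempotent by blast
  qed
  then have "1 / of_nat n * trace (T z) \<in> \<real> \<and> 0 \<le> Re (1 / of_nat n * trace (T z))"
    if "z \<in> S_group n" for z
    using that by (auto intro!: Reals_divide)
  then show ?thesis unfolding FS by (auto intro!: sum_nonneg)
qed

end
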